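(* Let $0\le a<b$, $f\in\mathcal C^2[a,b]$, and let $\beta\in\mathbb R$ with $\beta\neq-1$ (additionally, $\beta>-1$ is required when $a=0$). For $N\in\mathbb N$, let $h=(b-a)/N$, $x_n=a+hn$, $x_{n+1/2}=a+h(n+1/2)$, and define $$E=\int_a^b x^\beta f(x)\,dx-\sum_{n=0}^{N-1}\frac{x_{n+1}^{\beta+1}-x_n^{\beta+1}}{\beta+1}f(x_{n+1/2}).$$ Then there exists a constant $K>0$, independent of $N$, such that, for all $N\in\mathbb N$, $$|E|\le\begin{cases}\dfrac{K}{N^2}, & \text{if } a>0,\\[2mm] \dfrac{K}{N^2}, & \text{if } a=0 \text{ and } \beta\ge0,\\[2mm] \dfrac{K}{N^2}, & \text{if } a=0,\ \beta\in(-1,0) \text{ and } f'(0)=0,\\[2mm] \dfrac{K}{N^{2+\beta}}, & \text{if } a=0,\ \beta\in(-1,0)\text{ and } f'(0)\neq0.\end{cases}$$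
   Context: $\mathbb N=\{1,2,3,\ldots\}$. *)

theory Defs
  imports "HOL-Analysis.Analysis"
begin

definition mesh_size :: "real \<Rightarrow> real \<Rightarrow> nat \<Rightarrow> real" where
  "mesh_size a b N = (b - a) / real N"

text \<open>The second argument is real so that the same function gives the nodes (integer index)
  and the midpoints (half-integer index).\<close>

definition mesh_pt :: "real \<Rightarrow> real \<Rightarrow> nat \<Rightarrow> real \<Rightarrow> real" where
  "mesh_pt a b N t = a + mesh_size a b N * t"

definition product_midpoint_rule ::
    "real \<Rightarrow> real \<Rightarrow> real \<Rightarrow> (real \<Rightarrow> real) \<Rightarrow> nat \<Rightarrow> real" where
  "product_midpoint_rule a b \<beta> f N =
     (\<Sum>n<N. (mesh_pt a b N (real n + 1) powr (\<beta> + 1) - mesh_pt a b N (real n) powr (\<beta> + 1))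
              / (\<beta> + 1) * f (mesh_pt a b N (real n + 1 / 2)))"

text \<open>In the library, \<open>0 powr \<beta> = 0\<close> for every \<open>\<beta>\<close>. When \<open>a = 0\<close> this only affects the integrand
  at the single point \<open>0\<close>; the node value \<open>0 powr (\<beta> + 1) = 0\<close> is the usual one since then
  \<open>\<beta> > -1\<close>.\<close>

definition quadrature_error ::
    "real \<Rightarrow> real \<Rightarrow> real \<Rightarrow> (real \<Rightarrow> real) \<Rightarrow> nat \<Rightarrow> real" where
  "quadrature_error a b \<beta> f N =
     integral {a..b} (\<lambda>x. x powr \<beta> * f x) - product_midpoint_rule a b \<beta> f N"

end

theory Submission
  imports Defs
begin

text \<open>On a cell with midpoint \<open>m\<close>, expand \<open>f x = f m + f' m * (x - m) + O(h\<^sup>2)\<close>.  The remainders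
  contribute \<open>O(h\<^sup>2)\<close> times the total mass of the weight, so everything depends on the first moments
  of the weight about the midpoints.  Since \<open>x powr \<beta>\<close> is monotone, such a moment is at most
  \<open>h\<^sup>2\<close> times the variation of the weight on the cell, and the variations telescope.  Only
  the cell touching a singularity at \<open>0\<close> needs the cruder bound \<open>h\<close> times the mass of the cell;
  if \<open>f' 0 = 0\<close>, then the factor \<open>f' m = O(m)\<close> compensates for the singularity.\<close>

section \<open>Mass and first moment of the power weight on one interval\<close>

definition powr_mass :: "real \<Rightarrow> real \<Rightarrow> real \<Rightarrow> real" where
  "powr_mass \<beta> u v = (v powr (\<beta> + 1) - u powr (\<beta> + 1)) / (\<beta> + 1)"

definition powr_moment :: "real \<Rightarrow> real \<Rightarrow> real \<Rightarrow> real" where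
  "powr_moment \<beta> u v = integral {u..v} (\<lambda>x. x powr \<beta> * (x - (u + v) / 2))"

text \<open>For \<open>u = 0\<close> the antiderivative need not have derivative
  \<open>0 powr \<beta>\<close> at the left endpoint, so the interior form of the fundamental
  theorem is used. It asks only for continuity there, which follows from
  \<open>\<beta> + 1 > 0\<close>; for \<open>u > 0\<close> any exponent will do.\<close>

lemma powr_has_integral:
  fixes u v \<beta> :: real
  assumes "0 \<le> u" "u \<le> v" "\<beta> \<noteq> -1" "u = 0 \<Longrightarrow> \<beta> > -1"
  shows "((\<lambda>x. x powr \<beta>) has_integral powr_mass \<beta> u v) {u..v}"
proof -
  have "((\<lambda>x. x powr \<beta>) has_integral
      (v powr (\<beta> + 1) / (\<beta> + 1) - u powr (\<beta> + 1) / (\<beta> + 1))) {u..v}"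
  proof (rule fundamental_theorem_of_calculus_interior)
    show "continuous_on {u..v} (\<lambda>x. x powr (\<beta> + 1) / (\<beta> + 1))"
    proof (cases "u = 0")
      case True
      then show ?thesis
        using assms by (intro continuous_intros continuous_on_powr') auto
    next
      case False
      then show ?thesis
        using assms by (intro continuous_intros) auto
    qed
    show "((\<lambda>x. x powr (\<beta> + 1) / (\<beta> + 1)) has_vector_derivative x powr \<beta>) (at x)"
      if "x \<in> {u<..<v}" for x
    proof -
      have "((\<lambda>x. x powr (\<beta> + 1) / (\<beta> + 1)) has_real_derivative x powr \<beta>) (at x)"
        using that assms by (auto intro!: derivative_eq_intros)
      then show ?thesis
        by (simp add: has_real_derivative_iff_has_vector_derivative)
    qed
  qed (use assms in auto)
  then show ?thesis
    by (simp add: powr_mass_def diff_divide_distrib)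
qed

lemma powr_mass_nonneg:
  assumes "0 \<le> u" "u \<le> v" "\<beta> \<noteq> -1" "u = 0 \<Longrightarrow> \<beta> > -1"
  shows "0 \<le> powr_mass \<beta> u v"
  using has_integral_nonneg[OF powr_has_integral[OF assms]] by simp

lemma powr_mult_integrable:
  fixes g :: "real \<Rightarrow> real"
  assumes "0 \<le> u" "u \<le> v" "\<beta> \<noteq> -1" "u = 0 \<Longrightarrow> \<beta> > -1"
    and "continuous_on {u..v} g"
  shows "(\<lambda>x. x powr \<beta> * g x) integrable_on {u..v}"
proof -
  have "(\<lambda>x. x powr \<beta>) absolutely_integrable_on {u..v}"
    using powr_has_integral[OF assms(1-4)]
    by (intro nonnegative_absolutely_integrable_1) auto
  moreover have "bounded (g ` {u..v})"
    using assms(5) by (intro compact_imp_bounded compact_continuous_image) auto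
  moreover have "g \<in> borel_measurable (lebesgue_on {u..v})"
    using assms(5) by (intro continuous_imp_measurable_on_sets_lebesgue) auto
  ultimately have "(\<lambda>x. g x * x powr \<beta>) absolutely_integrable_on {u..v}"
    by (intro absolutely_integrable_bounded_measurable_product_real) auto
  then show ?thesis
    by (simp add: mult.commute set_lebesgue_integral_eq_integral(1))
qed

lemma powr_integral_bound:
  fixes g :: "real \<Rightarrow> real"
  assumes "0 \<le> u" "u \<le> v" "\<beta> \<noteq> -1" "u = 0 \<Longrightarrow> \<beta> > -1"
    and "continuous_on {u..v} g" and "\<And>x. x \<in> {u..v} \<Longrightarrow> \<bar>g x\<bar> \<le> B"
  shows "\<bar>integral {u..v} (\<lambda>x. x powr \<beta> * g x)\<bar> \<le> B * powr_mass \<beta> u v"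
proof -
  have "norm (integral {u..v} (\<lambda>x. x powr \<beta> * g x)) \<le> integral {u..v} (\<lambda>x. B * x powr \<beta>)"
  proof (rule integral_norm_bound_integral)
    show "(\<lambda>x. x powr \<beta> * g x) integrable_on {u..v}"
      by (rule powr_mult_integrable) (use assms in auto)
    show "(\<lambda>x. B * x powr \<beta>) integrable_on {u..v}"
      using has_integral_mult_right[OF powr_has_integral[OF assms(1-4)]] by blast
    show "norm (x powr \<beta> * g x) \<le> B * x powr \<beta>" if "x \<in> {u..v}" for x
      using mult_right_mono[OF assms(6)[OF that], of "x powr \<beta>"]
      by (simp add: abs_mult mult.commute)
  qed
  also have "\<dots> = B * powr_mass \<beta> u v"
    using powr_has_integral[OF assms(1-4)] by (simp add: integral_unique)
  finally show ?thesis by simp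
qed

text \<open>The crude bound: points of the interval are within \<open>v - u\<close> of the midpoint.
  It tolerates a singularity at \<open>u = 0\<close>, which is why it handles the first cell
  later.\<close>

lemma powr_moment_le_mass:
  assumes "0 \<le> u" "u \<le> v" "\<beta> \<noteq> -1" "u = 0 \<Longrightarrow> \<beta> > -1"
  shows "\<bar>powr_moment \<beta> u v\<bar> \<le> (v - u) * powr_mass \<beta> u v"
  unfolding powr_moment_def
  by (rule powr_integral_bound) (use assms in \<open>auto intro!: continuous_intros simp: abs_le_iff field_simps\<close>)

text \<open>By monotonicity both values lie between the endpoint values. For
  \<open>\<beta> < 0\<close> the point \<open>u = 0\<close> must be excluded, since the convention
  \<open>0 powr \<beta> = 0\<close> breaks monotonicity there.\<close>

lemma powr_between:
  fixes u v x y \<beta> :: real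
  assumes "0 \<le> u" "u > 0 \<or> \<beta> \<ge> 0" "x \<in> {u..v}" "y \<in> {u..v}"
  shows "\<bar>x powr \<beta> - y powr \<beta>\<bar> \<le> \<bar>v powr \<beta> - u powr \<beta>\<bar>"
proof (cases "\<beta> \<ge> 0")
  case True
  have "u powr \<beta> \<le> z powr \<beta> \<and> z powr \<beta> \<le> v powr \<beta>" if "z \<in> {u..v}" for z
    using that assms True by (auto intro!: powr_mono2)
  from this[OF assms(3)] this[OF assms(4)] show ?thesis by linarith
next
  case False
  have "v powr \<beta> \<le> z powr \<beta> \<and> z powr \<beta> \<le> u powr \<beta>" if "z \<in> {u..v}" for z
    using that assms False by (auto intro!: powr_mono2')
  from this[OF assms(3)] this[OF assms(4)] show ?thesis by linarith
qed

text \<open>As \<open>x - m\<close> has integral zero about the midpoint \<open>m\<close>, the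
  constant \<open>m powr \<beta>\<close> can be subtracted from the weight. Each factor of the new
  integrand is then small: one by the variation, the other by the length; integrating contributes
  the second factor \<open>v - u\<close>.\<close>

lemma powr_moment_le_variation:
  assumes "0 \<le> u" "u \<le> v" "\<beta> \<noteq> -1" "u > 0 \<or> \<beta> \<ge> 0"
  shows "\<bar>powr_moment \<beta> u v\<bar> \<le> (v - u)\<^sup>2 * \<bar>v powr \<beta> - u powr \<beta>\<bar>"
proof -
  define m where "m = (u + v) / 2"
  have "((\<lambda>x. x - m) has_integral ((v\<^sup>2 - u\<^sup>2) / 2 - (v - u) * m)) {u..v}"
    using has_integral_diff[OF ident_has_integral[of u v] has_integral_const_real[of m u v]] assms
    by simp
  moreover have "(v\<^sup>2 - u\<^sup>2) / 2 - (v - u) * m = 0"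
    by (simp add: m_def power2_eq_square field_simps)
  ultimately have "((\<lambda>x. m powr \<beta> * (x - m)) has_integral 0) {u..v}"
    using has_integral_mult_right[of "\<lambda>x. x - m" 0 "{u..v}" "m powr \<beta>"] by simp
  moreover have "(\<lambda>x. x powr \<beta> * (x - m)) integrable_on {u..v}"
    by (rule powr_mult_integrable) (use assms in \<open>auto intro!: continuous_intros\<close>)
  ultimately have "((\<lambda>x. x powr \<beta> * (x - m) - m powr \<beta> * (x - m))
      has_integral powr_moment \<beta> u v - 0) {u..v}"
    unfolding powr_moment_def m_def by (intro has_integral_diff) (auto simp: integrable_integral)
  then have "((\<lambda>x. (x powr \<beta> - m powr \<beta>) * (x - m)) has_integral powr_moment \<beta> u v) (cbox u v)"
    by (simp add: left_diff_distrib)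
  then have "norm (powr_moment \<beta> u v)
      \<le> (\<bar>v powr \<beta> - u powr \<beta>\<bar> * (v - u)) * measure lborel (cbox u v)"
  proof (rule has_integral_bound[rotated])
    show "norm ((x powr \<beta> - m powr \<beta>) * (x - m)) \<le> \<bar>v powr \<beta> - u powr \<beta>\<bar> * (v - u)"
      if "x \<in> cbox u v" for x
      unfolding real_norm_def abs_mult
      by (intro mult_mono powr_between) (use that assms in \<open>auto simp: m_def abs_le_iff field_simps\<close>)
  qed (use assms in auto)
  then show ?thesis
    using assms by (simp add: power2_eq_square algebra_simps)
qed

text \<open>A decreasing weight is smallest at the right endpoint. The mean value theorem for the
  antiderivative gives this even for \<open>u = 0\<close>, where only continuity holds.\<close>

lemma right_endpoint_le_powr_mass:
  fixes u v \<beta> :: real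
  assumes "0 \<le> u" "u < v" "-1 < \<beta>" "\<beta> \<le> 0"
  shows "(v - u) * v powr \<beta> \<le> powr_mass \<beta> u v"
proof -
  have "continuous_on {u..v} (\<lambda>x. x powr (\<beta> + 1) / (\<beta> + 1))"
    using assms by (intro continuous_intros continuous_on_powr') auto
  moreover have "((\<lambda>x. x powr (\<beta> + 1) / (\<beta> + 1)) has_derivative (\<lambda>h. x powr \<beta> * h)) (at x)"
    if "u < x" for x
    unfolding has_field_derivative_def[symmetric]
    using that assms by (auto intro!: derivative_eq_intros)
  ultimately obtain z where z: "u < z" "z < v"
    "v powr (\<beta> + 1) / (\<beta> + 1) - u powr (\<beta> + 1) / (\<beta> + 1) = z powr \<beta> * (v - u)"
    using mvt[OF \<open>u < v\<close>, of "\<lambda>x. x powr (\<beta> + 1) / (\<beta> + 1)" "\<lambda>x h. x powr \<beta> * h"] by blast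
  have "v powr \<beta> \<le> z powr \<beta>"
    using z assms by (intro powr_mono2') auto
  then show ?thesis
    using z assms by (simp add: powr_mass_def diff_divide_distrib mult.commute mult_right_mono)
qed

lemma sum_abs_variation:
  fixes w :: "nat \<Rightarrow> real"
  assumes "(\<forall>n. w n \<le> w (Suc n)) \<or> (\<forall>n. w (Suc n) \<le> w n)"
  shows "(\<Sum>n<k. \<bar>w (Suc n) - w n\<bar>) = \<bar>w k - w 0\<bar>"
  using assms
proof
  assume w: "\<forall>n. w n \<le> w (Suc n)"
  then have "w 0 \<le> w k" by (simp add: lift_Suc_mono_le)
  then show ?thesis using w sum_lessThan_telescope[of w k] by simp
next
  assume w: "\<forall>n. w (Suc n) \<le> w n"
  then have "w k \<le> w 0" by (simp add: lift_Suc_antimono_le)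
  then show ?thesis using w sum_lessThan_telescope'[of w k] by simp
qed

section \<open>Taylor expansion and the error on a single cell\<close>

locale product_quadrature =
  fixes a b \<beta> M :: real and f f' f'' :: "real \<Rightarrow> real"
  assumes a_nonneg: "0 \<le> a" and a_less_b: "a < b"
    and deriv_f: "\<And>x. x \<in> {a..b} \<Longrightarrow> (f has_real_derivative f' x) (at x within {a..b})"
    and deriv_f': "\<And>x. x \<in> {a..b} \<Longrightarrow> (f' has_real_derivative f'' x) (at x within {a..b})"
    and f''_bound: "\<And>x. x \<in> {a..b} \<Longrightarrow> \<bar>f'' x\<bar> \<le> M"
    and \<beta>_neq: "\<beta> \<noteq> -1" and \<beta>_gt: "a = 0 \<Longrightarrow> \<beta> > -1"
begin

lemma M_nonneg: "0 \<le> M"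
  using f''_bound[of a] a_less_b by auto

lemma f'_lipschitz:
  assumes "x \<in> {a..b}" "y \<in> {a..b}"
  shows "\<bar>f' x - f' y\<bar> \<le> M * \<bar>x - y\<bar>"
  using field_differentiable_bound[of "{a..b}" f' f'' M x y] deriv_f' f''_bound assms by auto

lemma f'_bound:
  assumes "x \<in> {a..b}"
  shows "\<bar>f' x\<bar> \<le> \<bar>f' a\<bar> + M * (b - a)"
proof -
  have "M * \<bar>x - a\<bar> \<le> M * (b - a)"
    using assms M_nonneg by (intro mult_left_mono) auto
  then show ?thesis
    using f'_lipschitz[of x a] assms a_less_b by auto
qed

lemma f_continuous: "continuous_on {a..b} f"
  using deriv_f by (meson DERIV_continuous_on)

text \<open>The mean value inequality is applied to \<open>f z - f' m * z\<close>, whose derivative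
  \<open>f' z - f' m\<close> is at most \<open>M * (v - u)\<close> by the Lipschitz bound. This
  loses a constant factor against the sharp remainder, which is harmless here.\<close>

lemma taylor_bound:
  assumes "a \<le> u" "v \<le> b" "x \<in> {u..v}" "m \<in> {u..v}"
  shows "\<bar>f x - f m - f' m * (x - m)\<bar> \<le> M * (v - u)\<^sup>2"
proof -
  have "norm ((f x - f' m * x) - (f m - f' m * m)) \<le> (M * (v - u)) * norm (x - m)"
  proof (rule field_differentiable_bound[of "{u..v}" _ "\<lambda>z. f' z - f' m"])
    fix z assume z: "z \<in> {u..v}"
    have "(f has_real_derivative f' z) (at z within {u..v})"
      using z assms by (intro DERIV_subset[OF deriv_f]) auto
    then show "((\<lambda>x. f x - f' m * x) has_real_derivative f' z - f' m) (at z within {u..v})"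
      by (auto intro!: derivative_eq_intros)
    have "\<bar>f' z - f' m\<bar> \<le> M * \<bar>z - m\<bar>"
      using z assms by (intro f'_lipschitz) auto
    also have "\<dots> \<le> M * (v - u)"
      using z assms M_nonneg by (intro mult_left_mono) auto
    finally show "norm (f' z - f' m) \<le> M * (v - u)" by simp
  qed (use assms in auto)
  also have "\<dots> \<le> (M * (v - u)) * (v - u)"
    using assms M_nonneg by (intro mult_left_mono) auto
  finally show ?thesis
    by (simp add: algebra_simps power2_eq_square)
qed

text \<open>The rule integrates the constant term \<open>f m\<close> of the expansion exactly, the
  linear term produces the moment, and the remainder \<open>r\<close> is bounded uniformly against
  the mass.\<close>

lemma cell_error_bound:
  assumes "a \<le> u" "u \<le> v" "v \<le> b"
  shows "\<bar>integral {u..v} (\<lambda>x. x powr \<beta> * f x) - powr_mass \<beta> u v * f ((u + v) / 2)\<bar>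
    \<le> \<bar>f' ((u + v) / 2)\<bar> * \<bar>powr_moment \<beta> u v\<bar> + M * (v - u)\<^sup>2 * powr_mass \<beta> u v"
proof -
  define m where "m = (u + v) / 2"
  define r where "r x = f x - f m - f' m * (x - m)" for x
  have uv: "0 \<le> u" "u \<le> v" "\<beta> \<noteq> -1" "u = 0 \<Longrightarrow> \<beta> > -1"
    using assms a_nonneg \<beta>_neq \<beta>_gt by auto
  have cont_f: "continuous_on {u..v} f"
    using f_continuous assms by (auto intro: continuous_on_subset)
  have "\<bar>integral {u..v} (\<lambda>x. x powr \<beta> * r x)\<bar> \<le> M * (v - u)\<^sup>2 * powr_mass \<beta> u v"
  proof (rule powr_integral_bound[OF uv])
    show "continuous_on {u..v} r"
      unfolding r_def by (intro continuous_intros cont_f)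
    show "\<bar>r x\<bar> \<le> M * (v - u)\<^sup>2" if "x \<in> {u..v}" for x
      unfolding r_def by (rule taylor_bound) (use that assms in \<open>auto simp: m_def\<close>)
  qed
  moreover have "((\<lambda>x. x powr \<beta> * f x - f m * x powr \<beta> - f' m * (x powr \<beta> * (x - m)))
      has_integral integral {u..v} (\<lambda>x. x powr \<beta> * f x) - f m * powr_mass \<beta> u v
        - f' m * powr_moment \<beta> u v) {u..v}"
    unfolding powr_moment_def m_def[symmetric]
    by (intro has_integral_diff has_integral_mult_right powr_has_integral[OF uv]
        integrable_integral powr_mult_integrable[OF uv] cont_f continuous_intros)
  then have "integral {u..v} (\<lambda>x. x powr \<beta> * r x) = integral {u..v} (\<lambda>x. x powr \<beta> * f x)
      - f m * powr_mass \<beta> u v - f' m * powr_moment \<beta> u v"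
    by (intro integral_unique) (simp add: r_def algebra_simps)
  moreover have "\<bar>f' m * powr_moment \<beta> u v\<bar> = \<bar>f' m\<bar> * \<bar>powr_moment \<beta> u v\<bar>"
    by (simp add: abs_mult)
  ultimately show ?thesis
    unfolding m_def[symmetric] by (simp add: mult.commute)
qed

section \<open>The mesh and summation of the cell errors\<close>

definition node :: "nat \<Rightarrow> nat \<Rightarrow> real" where
  "node N n = mesh_pt a b N (real n)"

text \<open>Written as a mean of neighbouring nodes to match \<open>(u + v) / 2\<close> in
  \<open>cell_error_bound\<close>; \<open>rule_eq_sum\<close> identifies it with the mesh point of
  half-integer index.\<close>

abbreviation midpt :: "nat \<Rightarrow> nat \<Rightarrow> real" where
  "midpt N n \<equiv> (node N n + node N (Suc n)) / 2"

abbreviation step :: "nat \<Rightarrow> real" where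
  "step N \<equiv> mesh_size a b N"

lemma step_pos: "N \<ge> 1 \<Longrightarrow> 0 < step N"
  using a_less_b by (simp add: mesh_size_def)

lemma node_Suc: "node N (Suc n) = node N n + step N"
  by (simp add: node_def mesh_pt_def algebra_simps)

lemma node_0: "node N 0 = a"
  by (simp add: node_def mesh_pt_def)

lemma node_last: "N \<ge> 1 \<Longrightarrow> node N N = b"
  by (simp add: node_def mesh_pt_def mesh_size_def)

lemma node_mono: "N \<ge> 1 \<Longrightarrow> m \<le> n \<Longrightarrow> node N m \<le> node N n"
  using step_pos[of N] by (simp add: node_def mesh_pt_def)

lemma node_in: "N \<ge> 1 \<Longrightarrow> n \<le> N \<Longrightarrow> node N n \<in> {a..b}"
  using node_mono[of N 0 n] node_mono[of N n N] by (simp add: node_0 node_last)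

lemma midpt_in: "N \<ge> 1 \<Longrightarrow> n < N \<Longrightarrow> midpt N n \<in> {a..b}"
  using node_in[of N n] node_in[of N "Suc n"] by auto

lemma rule_eq_sum:
  "product_midpoint_rule a b \<beta> f N =
    (\<Sum>n<N. powr_mass \<beta> (node N n) (node N (Suc n)) * f (midpt N n))"
  unfolding product_midpoint_rule_def powr_mass_def
  by (intro sum.cong refl) (simp add: node_def mesh_pt_def field_simps)

lemma sum_powr_mass:
  assumes "N \<ge> 1"
  shows "(\<Sum>n<N. powr_mass \<beta> (node N n) (node N (Suc n))) = powr_mass \<beta> a b"
  using sum_lessThan_telescope[of "\<lambda>n. node N n powr (\<beta> + 1)" N] assms
  by (simp add: powr_mass_def node_0 node_last sum_divide_distrib[symmetric])

lemma integral_eq_sum: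
  assumes "N \<ge> 1"
  shows "integral {a..b} (\<lambda>x. x powr \<beta> * f x)
    = (\<Sum>n<N. integral {node N n..node N (Suc n)} (\<lambda>x. x powr \<beta> * f x))"
proof -
  have int: "(\<lambda>x. x powr \<beta> * f x) integrable_on {a..b}"
    using a_nonneg a_less_b \<beta>_neq \<beta>_gt f_continuous by (intro powr_mult_integrable) auto
  have "integral {a..node N n} (\<lambda>x. x powr \<beta> * f x)
      = (\<Sum>k<n. integral {node N k..node N (Suc k)} (\<lambda>x. x powr \<beta> * f x))" if "n \<le> N" for n
    using that
  proof (induction n)
    case 0
    then show ?case by (simp add: node_0)
  next
    case (Suc n)
    have "(\<lambda>x. x powr \<beta> * f x) integrable_on {a..node N (Suc n)}"
      by (rule integrable_on_subinterval[OF int]) (use node_in[of N "Suc n"] Suc assms in auto)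
    then have "integral {a..node N n} (\<lambda>x. x powr \<beta> * f x)
        + integral {node N n..node N (Suc n)} (\<lambda>x. x powr \<beta> * f x)
        = integral {a..node N (Suc n)} (\<lambda>x. x powr \<beta> * f x)"
      using node_in[of N n] node_mono[of N n "Suc n"] Suc assms
      by (intro Henstock_Kurzweil_Integration.integral_combine) auto
    then show ?case using Suc by simp
  qed
  from this[of N] show ?thesis using assms by (simp add: node_last)
qed

text \<open>The cell masses add up to the mass of the whole interval, so the remainders give the
  final term. Only the weighted sum of moments is left for the separate cases.\<close>

lemma quadrature_error_bound:
  assumes "N \<ge> 1"
  shows "\<bar>quadrature_error a b \<beta> f N\<bar>
    \<le> (\<Sum>n<N. \<bar>f' (midpt N n)\<bar> * \<bar>powr_moment \<beta> (node N n) (node N (Suc n))\<bar>)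
      + M * (step N)\<^sup>2 * powr_mass \<beta> a b"
proof -
  have "\<bar>quadrature_error a b \<beta> f N\<bar>
      = \<bar>\<Sum>n<N. integral {node N n..node N (Suc n)} (\<lambda>x. x powr \<beta> * f x)
          - powr_mass \<beta> (node N n) (node N (Suc n)) * f (midpt N n)\<bar>"
    unfolding quadrature_error_def rule_eq_sum integral_eq_sum[OF assms] sum_subtractf ..
  also have "\<dots> \<le> (\<Sum>n<N. \<bar>f' (midpt N n)\<bar> * \<bar>powr_moment \<beta> (node N n) (node N (Suc n))\<bar>
      + M * (step N)\<^sup>2 * powr_mass \<beta> (node N n) (node N (Suc n)))"
  proof (rule order_trans[OF sum_abs], rule sum_mono)
    fix n assume "n \<in> {..<N}"
    moreover have "step N = node N (Suc n) - node N n"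
      by (simp add: node_Suc)
    ultimately show "\<bar>integral {node N n..node N (Suc n)} (\<lambda>x. x powr \<beta> * f x)
          - powr_mass \<beta> (node N n) (node N (Suc n)) * f (midpt N n)\<bar>
        \<le> \<bar>f' (midpt N n)\<bar> * \<bar>powr_moment \<beta> (node N n) (node N (Suc n))\<bar>
          + M * (step N)\<^sup>2 * powr_mass \<beta> (node N n) (node N (Suc n))"
      using node_in[of N n] node_in[of N "Suc n"] node_mono[of N n "Suc n"] assms
      by (auto intro!: cell_error_bound)
  qed
  also have "\<dots> = (\<Sum>n<N. \<bar>f' (midpt N n)\<bar> * \<bar>powr_moment \<beta> (node N n) (node N (Suc n))\<bar>)
      + M * (step N)\<^sup>2 * powr_mass \<beta> a b"
    by (simp add: sum.distrib sum_distrib_left[symmetric] sum_powr_mass[OF assms])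
  finally show ?thesis .
qed

section \<open>Second order for a weight without singularity\<close>

lemma moment_le_variation:
  assumes "N \<ge> 1" "n < N" "node N n > 0 \<or> \<beta> \<ge> 0"
  shows "\<bar>powr_moment \<beta> (node N n) (node N (Suc n))\<bar>
    \<le> (step N)\<^sup>2 * \<bar>node N (Suc n) powr \<beta> - node N n powr \<beta>\<bar>"
  using powr_moment_le_variation[of "node N n" "node N (Suc n)" \<beta>]
    node_in[of N n] a_nonneg step_pos[of N] assms \<beta>_neq
  by (simp add: node_Suc)

lemma error_regular:
  assumes "a > 0 \<or> \<beta> \<ge> 0" "N \<ge> 1"
  shows "\<bar>quadrature_error a b \<beta> f N\<bar>
    \<le> ((\<bar>f' a\<bar> + M * (b - a)) * \<bar>b powr \<beta> - a powr \<beta>\<bar> + M * powr_mass \<beta> a b) * (step N)\<^sup>2"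
proof -
  let ?D = "\<bar>f' a\<bar> + M * (b - a)"
  let ?w = "\<lambda>n. node N n powr \<beta>"
  have D: "0 \<le> ?D" using M_nonneg a_less_b by simp
  have pos: "node N n \<ge> 0" "node N n > 0 \<or> \<beta> \<ge> 0" for n
    using node_mono[of N 0 n] a_nonneg assms by (auto simp: node_0)
  \<comment> \<open>With \<open>f'\<close> bounded uniformly by \<open>?D\<close>, the moments are
    controlled by the total variation of the weight over the nodes, which telescopes; the sign of
    \<open>\<beta>\<close> only decides its direction.\<close>
  have "(\<Sum>n<N. \<bar>f' (midpt N n)\<bar> * \<bar>powr_moment \<beta> (node N n) (node N (Suc n))\<bar>)
      \<le> (\<Sum>n<N. ?D * ((step N)\<^sup>2 * \<bar>?w (Suc n) - ?w n\<bar>))"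
    by (intro sum_mono mult_mono f'_bound midpt_in moment_le_variation pos D) (use assms in auto)
  also have "\<dots> = ?D * (step N)\<^sup>2 * (\<Sum>n<N. \<bar>?w (Suc n) - ?w n\<bar>)"
    by (simp add: sum_distrib_left mult.assoc)
  also have "(\<Sum>n<N. \<bar>?w (Suc n) - ?w n\<bar>) = \<bar>?w N - ?w 0\<bar>"
  proof (rule sum_abs_variation, cases "\<beta> \<ge> 0")
    case True
    then show "(\<forall>n. ?w n \<le> ?w (Suc n)) \<or> (\<forall>n. ?w (Suc n) \<le> ?w n)"
      using pos node_mono[of N] assms by (auto intro!: powr_mono2)
  next
    case False
    then show "(\<forall>n. ?w n \<le> ?w (Suc n)) \<or> (\<forall>n. ?w (Suc n) \<le> ?w n)"
      using pos node_mono[of N] assms by (auto intro!: powr_mono2')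
  qed
  finally show ?thesis
    using quadrature_error_bound[of N] assms by (simp add: node_0 node_last algebra_simps)
qed

end

section \<open>The singular weight: \<open>a = 0\<close> and \<open>-1 < \<beta> < 0\<close>\<close>

locale singular_product_quadrature = product_quadrature +
  assumes a_eq_0: "a = 0" and \<beta>_neg: "\<beta> < 0"
begin

lemma \<beta>_gt': "-1 < \<beta>"
  using a_eq_0 \<beta>_gt by simp

lemma node_0_eq_0: "node N 0 = 0"
  by (rule trans[OF node_0 a_eq_0])

lemma node_1: "node N (Suc 0) = step N"
  by (simp add: node_Suc node_0_eq_0)

lemma node_pos: "N \<ge> 1 \<Longrightarrow> n \<ge> 1 \<Longrightarrow> 0 < node N n"
  using step_pos[of N] a_nonneg by (simp add: node_def mesh_pt_def add_nonneg_pos)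

lemma powr_mass_nonneg': "0 \<le> u \<Longrightarrow> u \<le> v \<Longrightarrow> 0 \<le> powr_mass \<beta> u v"
  using powr_mass_nonneg \<beta>_gt' by auto

lemma moment_first:
  assumes "N \<ge> 1"
  shows "\<bar>powr_moment \<beta> (node N 0) (node N (Suc 0))\<bar> \<le> step N * powr_mass \<beta> 0 (step N)"
  using powr_moment_le_mass[of 0 "step N" \<beta>] step_pos[OF assms] \<beta>_gt'
  by (simp add: node_1 node_0_eq_0)

text \<open>Index \<open>0\<close> must be left out: there the convention
  \<open>0 powr \<beta> = 0\<close> puts the value below its successor.\<close>

lemma node_powr_decreasing:
  assumes "N \<ge> 1" "n \<ge> 1"
  shows "node N (Suc n) powr \<beta> \<le> node N n powr \<beta>"
  using node_pos[of N n] node_mono[of N n "Suc n"] assms \<beta>_neg by (intro powr_mono2') auto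

text \<open>The first cell contributes \<open>h\<close> times its mass, that is
  \<open>h powr (2 + \<beta>) / (\<beta> + 1)\<close>. On the other cells the variation is at most
  the weight at the first positive node, which contributes
  \<open>h\<^sup>2 * h powr \<beta>\<close>, of the same order. Hence the factor
  \<open>1 / (\<beta> + 1) + 1\<close>.\<close>

lemma error_singular:
  assumes "N \<ge> 1"
  shows "\<bar>quadrature_error a b \<beta> f N\<bar>
    \<le> (\<bar>f' a\<bar> + M * (b - a)) * (1 / (\<beta> + 1) + 1) * step N powr (2 + \<beta>)
      + M * powr_mass \<beta> a b * (step N)\<^sup>2"
proof -
  obtain k where k: "N = Suc k" using assms by (cases N) auto
  let ?D = "\<bar>f' a\<bar> + M * (b - a)"
  \<comment> \<open>Shifted by one, so that the telescoping starts at the node \<open>h\<close> and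
    avoids the singularity.\<close>
  let ?w = "\<lambda>n. node N (Suc n) powr \<beta>"
  let ?h = "step N"
  have h: "0 < ?h" using step_pos assms by simp
  have D: "0 \<le> ?D" using M_nonneg a_less_b by simp
  have "(\<Sum>n<N. \<bar>f' (midpt N n)\<bar> * \<bar>powr_moment \<beta> (node N n) (node N (Suc n))\<bar>)
      \<le> (\<Sum>n<N. ?D * \<bar>powr_moment \<beta> (node N n) (node N (Suc n))\<bar>)"
    by (intro sum_mono mult_right_mono f'_bound midpt_in) (use assms in auto)
  also have "\<dots> = ?D * (\<bar>powr_moment \<beta> (node N 0) (node N (Suc 0))\<bar>
      + (\<Sum>n<k. \<bar>powr_moment \<beta> (node N (Suc n)) (node N (Suc (Suc n)))\<bar>))"
    unfolding sum_distrib_left[symmetric] k sum.lessThan_Suc_shift ..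
  also have "\<dots> \<le> ?D * (?h * powr_mass \<beta> 0 ?h + (\<Sum>n<k. ?h\<^sup>2 * \<bar>?w (Suc n) - ?w n\<bar>))"
    using assms k
    by (intro mult_left_mono[OF _ D] add_mono moment_first sum_mono moment_le_variation
        disjI1 node_pos) auto
  also have "(\<Sum>n<k. ?h\<^sup>2 * \<bar>?w (Suc n) - ?w n\<bar>) = ?h\<^sup>2 * \<bar>?w k - ?w 0\<bar>"
    unfolding sum_distrib_left[symmetric]
    using assms by (subst sum_abs_variation) (auto intro!: node_powr_decreasing)
  also have "?D * (?h * powr_mass \<beta> 0 ?h + ?h\<^sup>2 * \<bar>?w k - ?w 0\<bar>)
      \<le> ?D * (?h * powr_mass \<beta> 0 ?h + ?h\<^sup>2 * ?h powr \<beta>)"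
  proof (intro mult_left_mono[OF _ D] add_left_mono mult_left_mono)
    \<comment> \<open>The weights are nonnegative, so a decrease from \<open>?w 0\<close> to
      \<open>?w k\<close> is at most \<open>?w 0\<close>.\<close>
    have "?w k \<le> ?w 0"
      using node_pos[of N 1] node_mono[of N 1 "Suc k"] assms \<beta>_neg by (intro powr_mono2') auto
    then show "\<bar>?w k - ?w 0\<bar> \<le> ?h powr \<beta>" by (simp add: node_1)
  qed simp
  also have "?D * (?h * powr_mass \<beta> 0 ?h + ?h\<^sup>2 * ?h powr \<beta>)
      = ?D * (1 / (\<beta> + 1) + 1) * ?h powr (2 + \<beta>)"
  proof -
    have "?h * ?h powr (\<beta> + 1) = ?h powr (2 + \<beta>)" "?h\<^sup>2 * ?h powr \<beta> = ?h powr (2 + \<beta>)"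
      using h by (simp_all add: powr_add power2_eq_square)
    then have "?h * powr_mass \<beta> 0 ?h + ?h\<^sup>2 * ?h powr \<beta> = (1 / (\<beta> + 1) + 1) * ?h powr (2 + \<beta>)"
      by (simp add: powr_mass_def distrib_right)
    then show ?thesis by simp
  qed
  finally show ?thesis
    using quadrature_error_bound[OF assms] by (simp add: mult.commute mult.left_commute)
qed

text \<open>Since \<open>f'\<close> vanishes at \<open>0\<close>, it is at most \<open>M\<close>
  times the distance to \<open>0\<close>, and this factor tames the variation of the weight. Cell
  \<open>0\<close> is charged to its own mass and every later cell to the mass of its predecessor,
  giving at most twice the total mass; the Taylor remainders supply the third copy.\<close>

lemma error_singular_stationary:
  assumes "f' 0 = 0" "N \<ge> 1"
  shows "\<bar>quadrature_error a b \<beta> f N\<bar> \<le> 3 * M * powr_mass \<beta> a b * (step N)\<^sup>2"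
proof -
  obtain k where k: "N = Suc k" using assms by (cases N) auto
  let ?x = "node N"
  let ?h = "step N"
  let ?A = "\<lambda>n. powr_mass \<beta> (?x n) (?x (Suc n))"
  have h: "0 < ?h" using step_pos assms by simp
  have f'_le: "\<bar>f' (midpt N n)\<bar> \<le> M * ?x (Suc n)" if "n < N" for n
  proof -
    have m: "midpt N n \<in> {a..b}" using midpt_in that assms by simp
    then have "\<bar>f' (midpt N n)\<bar> \<le> M * midpt N n"
      using f'_lipschitz[of "midpt N n" 0] assms(1) a_eq_0 a_less_b by auto
    also have "\<dots> \<le> M * ?x (Suc n)"
      using M_nonneg node_mono[of N n "Suc n"] assms by (intro mult_left_mono) auto
    finally show ?thesis .
  qed
  have A: "0 \<le> ?A n" for n
    using node_mono[of N 0 n] node_mono[of N n "Suc n"] assms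
    by (intro powr_mass_nonneg') (auto simp: node_0_eq_0)
  have first: "\<bar>f' (midpt N 0)\<bar> * \<bar>powr_moment \<beta> (?x 0) (?x (Suc 0))\<bar> \<le> M * ?h\<^sup>2 * ?A 0"
  proof -
    have "\<bar>f' (midpt N 0)\<bar> * \<bar>powr_moment \<beta> (?x 0) (?x (Suc 0))\<bar>
        \<le> (M * ?x (Suc 0)) * (?h * powr_mass \<beta> 0 ?h)"
      using M_nonneg h assms by (intro mult_mono f'_le moment_first) (auto simp: node_1)
    then show ?thesis
      by (simp add: node_1 node_0_eq_0 power2_eq_square algebra_simps)
  qed
  have later: "\<bar>f' (midpt N (Suc n))\<bar> * \<bar>powr_moment \<beta> (?x (Suc n)) (?x (Suc (Suc n)))\<bar>
      \<le> M * ?h\<^sup>2 * ?A n" if "n < k" for n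
  proof -
    define u v where "u = ?x (Suc n)" and "v = ?x (Suc (Suc n))"
    have uv: "0 < u" "u < v" "v = u + ?h"
      using node_pos[of N "Suc n"] h assms by (auto simp: u_def v_def node_Suc)
    have dec: "v powr \<beta> \<le> u powr \<beta>"
      unfolding u_def v_def using node_powr_decreasing assms by simp
    have "v * \<bar>v powr \<beta> - u powr \<beta>\<bar> = ?h * u powr \<beta> + u powr (\<beta> + 1) - v powr (\<beta> + 1)"
      using dec uv by (simp add: powr_add algebra_simps)
    also have "\<dots> \<le> ?h * u powr \<beta>"
      using uv \<beta>_gt' by (simp add: powr_mono2)
    \<comment> \<open>\<open>?h * u powr \<beta>\<close> is the rectangle of right-endpoint height
      on the preceding cell, which ends at \<open>u\<close>.\<close>
    also have "\<dots> \<le> ?A n"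
      using right_endpoint_le_powr_mass[of "?x n" u \<beta>] node_mono[of N 0 n] h assms \<beta>_gt' \<beta>_neg
      by (simp add: u_def node_Suc node_0_eq_0)
    finally have *: "v * \<bar>v powr \<beta> - u powr \<beta>\<bar> \<le> ?A n" .
    have "\<bar>f' (midpt N (Suc n))\<bar> * \<bar>powr_moment \<beta> u v\<bar>
        \<le> (M * v) * (?h\<^sup>2 * \<bar>v powr \<beta> - u powr \<beta>\<bar>)"
      unfolding u_def v_def
      using M_nonneg uv that k assms
      by (intro mult_mono f'_le moment_le_variation disjI1 node_pos) (auto simp: v_def)
    also have "\<dots> = M * ?h\<^sup>2 * (v * \<bar>v powr \<beta> - u powr \<beta>\<bar>)"
      by simp
    also have "\<dots> \<le> M * ?h\<^sup>2 * ?A n"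
      using * M_nonneg by (intro mult_left_mono) auto
    finally show ?thesis by (simp add: u_def v_def)
  qed
  have "(\<Sum>n<N. \<bar>f' (midpt N n)\<bar> * \<bar>powr_moment \<beta> (?x n) (?x (Suc n))\<bar>)
      \<le> M * ?h\<^sup>2 * ?A 0 + (\<Sum>n<k. M * ?h\<^sup>2 * ?A n)"
    unfolding k sum.lessThan_Suc_shift unfolding k[symmetric]
    by (intro add_mono sum_mono first later) auto
  also have "\<dots> = M * ?h\<^sup>2 * (?A 0 + (\<Sum>n<k. ?A n))"
    by (simp add: sum_distrib_left algebra_simps)
  also have "\<dots> \<le> M * ?h\<^sup>2 * (2 * powr_mass \<beta> a b)"
  proof (rule mult_left_mono)
    \<comment> \<open>Cell \<open>0\<close> alone and the first \<open>k\<close> cells are each a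
      subfamily of all cells, whence the factor 2.\<close>
    have "(\<Sum>n\<in>{0}. ?A n) \<le> (\<Sum>n<N. ?A n)" "(\<Sum>n<k. ?A n) \<le> (\<Sum>n<N. ?A n)"
      by (intro sum_mono2; use A k in auto)+
    then show "?A 0 + (\<Sum>n<k. ?A n) \<le> 2 * powr_mass \<beta> a b"
      using sum_powr_mass assms by simp
  qed (use M_nonneg in auto)
  finally show ?thesis
    using quadrature_error_bound[of N] assms by (simp add: algebra_simps)
qed

end

section \<open>From powers of the step size to powers of \<open>N\<close>, with one positive
  constant\<close>

theorem theorem1:
  fixes a b \<beta> :: real and f f' f'' :: "real \<Rightarrow> real"
  assumes "0 \<le> a" and "a < b"
    and "\<And>x. x \<in> {a..b} \<Longrightarrow> (f has_real_derivative f' x) (at x within {a..b})"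
    and "\<And>x. x \<in> {a..b} \<Longrightarrow> (f' has_real_derivative f'' x) (at x within {a..b})"
    and "continuous_on {a..b} f''"
    and "\<beta> \<noteq> -1" and "a = 0 \<Longrightarrow> \<beta> > -1"
  shows "\<exists>K>0. \<forall>N\<ge>1.
      (a > 0 \<longrightarrow> \<bar>quadrature_error a b \<beta> f N\<bar> \<le> K / real N ^ 2) \<and>
      (a = 0 \<and> \<beta> \<ge> 0 \<longrightarrow> \<bar>quadrature_error a b \<beta> f N\<bar> \<le> K / real N ^ 2) \<and>
      (a = 0 \<and> \<beta> \<in> {-1<..<0} \<and> f' 0 = 0 \<longrightarrow>
         \<bar>quadrature_error a b \<beta> f N\<bar> \<le> K / real N ^ 2) \<and>
      (a = 0 \<and> \<beta> \<in> {-1<..<0} \<and> f' 0 \<noteq> 0 \<longrightarrow>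
         \<bar>quadrature_error a b \<beta> f N\<bar> \<le> K / real N powr (2 + \<beta>))"
proof -
  \<comment> \<open>Compactness turns continuity of \<open>f''\<close> into the bound
    \<open>M\<close> that the locale assumes.\<close>
  have "bounded (f'' ` {a..b})"
    using assms(5) by (intro compact_imp_bounded compact_continuous_image) auto
  then obtain M where M: "\<forall>x\<in>{a..b}. \<bar>f'' x\<bar> \<le> M"
    by (auto simp: bounded_iff)
  interpret product_quadrature a b \<beta> M f f' f''
    by unfold_locales (use assms M in auto)
  \<comment> \<open>The constants obtained above may vanish while \<open>K\<close> must be positive,
    hence \<open>max C 1\<close>. The denominator \<open>d\<close> is kept general to serve both
    rates.\<close>
  have enlarge: "\<exists>K>0. \<forall>N\<ge>1. \<bar>quadrature_error a b \<beta> f N\<bar> \<le> K / d N"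
    if "\<And>N. N \<ge> 1 \<Longrightarrow> \<bar>quadrature_error a b \<beta> f N\<bar> \<le> C / d N"
      and "\<And>N. N \<ge> 1 \<Longrightarrow> 0 < d N" for C :: real and d :: "nat \<Rightarrow> real"
  proof (intro exI[of _ "max C 1"] conjI allI impI)
    fix N :: nat assume N: "N \<ge> 1"
    have "C / d N \<le> max C 1 / d N"
      using that(2)[OF N] by (intro divide_right_mono) auto
    with that(1)[OF N] show "\<bar>quadrature_error a b \<beta> f N\<bar> \<le> max C 1 / d N" by linarith
  qed simp
  have sq: "\<exists>K>0. \<forall>N\<ge>1. \<bar>quadrature_error a b \<beta> f N\<bar> \<le> K / real N ^ 2"
    if "\<And>N. N \<ge> 1 \<Longrightarrow> \<bar>quadrature_error a b \<beta> f N\<bar> \<le> C * (step N)\<^sup>2" for C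
    using that by (intro enlarge[of "C * (b - a)\<^sup>2"]) (auto simp: mesh_size_def power_divide)
  \<comment> \<open>The distinction does not involve \<open>N\<close>, so \<open>K\<close> may be
    chosen separately in each case; the implications belonging to other cases hold
    vacuously.\<close>
  consider "a > 0 \<or> \<beta> \<ge> 0" | "a = 0" "\<beta> < 0" "f' 0 = 0" | "a = 0" "\<beta> < 0" "f' 0 \<noteq> 0"
    using a_nonneg by force
  then show ?thesis
  proof cases
    case 1
    from sq[OF error_regular[OF 1]] show ?thesis using 1 by auto
  next
    case 2
    interpret singular_product_quadrature a b \<beta> M f f' f''
      by unfold_locales (use 2 in auto)
    from sq[OF error_singular_stationary[OF 2(3)]] show ?thesis using 2 by auto
  next
    case 3
    interpret singular_product_quadrature a b \<beta> M f f' f''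
      by unfold_locales (use 3 in auto)
    define C where "C = (\<bar>f' a\<bar> + M * (b - a)) * (1 / (\<beta> + 1) + 1)"
    have "\<exists>K>0. \<forall>N\<ge>1. \<bar>quadrature_error a b \<beta> f N\<bar> \<le> K / real N powr (2 + \<beta>)"
    proof (rule enlarge)
      fix N :: nat assume N: "N \<ge> 1"
      \<comment> \<open>As \<open>\<beta> < 0\<close>, the quadratic remainder decays at least as
        fast as the singular rate and is absorbed into it.\<close>
      have "real N powr (2 + \<beta>) \<le> real N powr 2"
        using N \<beta>_neg by (intro powr_mono) auto
      then have "(step N)\<^sup>2 \<le> (b - a)\<^sup>2 / real N powr (2 + \<beta>)"
        using N by (simp add: mesh_size_def power_divide frac_le)
      then have "M * powr_mass \<beta> a b * (step N)\<^sup>2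
          \<le> M * powr_mass \<beta> a b * ((b - a)\<^sup>2 / real N powr (2 + \<beta>))"
        using M_nonneg powr_mass_nonneg'[of a b] a_nonneg a_less_b by (intro mult_left_mono) auto
      moreover have "step N powr (2 + \<beta>) = (b - a) powr (2 + \<beta>) / real N powr (2 + \<beta>)"
        using a_less_b by (simp add: mesh_size_def powr_divide)
      ultimately show "\<bar>quadrature_error a b \<beta> f N\<bar>
          \<le> (C * (b - a) powr (2 + \<beta>) + M * powr_mass \<beta> a b * (b - a)\<^sup>2) / real N powr (2 + \<beta>)"
        using error_singular[OF N] by (simp add: C_def add_divide_distrib)
    qed auto
    then show ?thesis using 3 by auto
  qed
qed

end
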